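(* For each integer $k\ge 3$ there is an absolute constant $C>0$ such that for all $n$, \[ c_{n,k} \ge C k^n \frac{r_k(kn)}{kn\log (kn)} = k^n \exp\left(-O(\log n)^{1/\lceil \log_2 k\rceil}\right). \]
   Context: $[m]=\{1,\dots,m\}$. A combinatorial line in $[k]^n$ is a set of $k$ distinct words in $[k]^n$ that can be placed as the rows of a $k\times n$ table such that every column belongs to $\{(x,x,\ldots,x): x\in[k]\}\cup\{(1,2,\ldots,k)\}$. The density Hales–Jewett number $c_{n,k}$ is the maximal cardinality of a subset of $[k]^n$ containing no combinatorial line. $r_k(N)$ denotes the maximal size of a subset of $[N]$ containing no arithmetic progression of length $k$. *)

theory Defs
  imports Complex_Main "HOL-Library.FuncSet" "HOL-Library.Landau_Symbols"
begin

definition words :: "nat \<Rightarrow> nat \<Rightarrow> (nat \<Rightarrow> nat) set" where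
  "words k n = {1..n} \<rightarrow>\<^sub>E {1..k}"

(* row i is the i-th row of the table, and row i j its entry in column j. *)
definition combinatorial_line :: "nat \<Rightarrow> nat \<Rightarrow> (nat \<Rightarrow> nat) set \<Rightarrow> bool" where
  "combinatorial_line k n L \<longleftrightarrow>
     (\<exists>row :: nat \<Rightarrow> nat \<Rightarrow> nat.
        L = row ` {1..k} \<and> inj_on row {1..k} \<and> row ` {1..k} \<subseteq> words k n \<and>
        (\<forall>j\<in>{1..n}. (\<exists>x\<in>{1..k}. \<forall>i\<in>{1..k}. row i j = x) \<or> (\<forall>i\<in>{1..k}. row i j = i)))"

definition line_free :: "nat \<Rightarrow> nat \<Rightarrow> (nat \<Rightarrow> nat) set \<Rightarrow> bool" where
  "line_free k n A \<longleftrightarrow> \<not> (\<exists>L. L \<subseteq> A \<and> combinatorial_line k n L)"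

definition dhj_number :: "nat \<Rightarrow> nat \<Rightarrow> nat" where
  "dhj_number n k = Max {card A | A. A \<subseteq> words k n \<and> line_free k n A}"

(* Progressions are non-constant. Taking d > 0 loses nothing, since only the set of
   terms matters. *)
definition ap_free :: "nat \<Rightarrow> nat set \<Rightarrow> bool" where
  "ap_free k A \<longleftrightarrow> \<not> (\<exists>a d. 0 < d \<and> (\<lambda>i. a + i * d) ` {..<k} \<subseteq> A)"

definition ap_free_number :: "nat \<Rightarrow> nat \<Rightarrow> nat" where
  "ap_free_number k N = Max {card A | A. A \<subseteq> {1..N} \<and> ap_free k A}"

end

theory Submission
  imports Defs "HOL-Computational_Algebra.Polynomial"
begin

text \<open>Along a combinatorial line the coordinate sum runs through a progression of length \<open>k\<close> whose
  difference is the number of active columns. Hence the words whose sum lies in a translate of a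
  progression-free subset of \<open>{1..k n}\<close> form a line-free set, and some translate is at least
  as popular as the average one.

  The exponential form rests on Rankin's lower bound for \<open>r\<^sub>k\<close>, proved by induction on \<open>s\<close> for
  sets without polynomial progressions of degree \<open>n\<close>, where \<open>k > 2\<^sup>s n\<close>. Take the vectors
  in \<open>{0..<m}\<^sup>d\<close> whose squared norm lies in a translate of a set without progressions of
  degree \<open>2 n\<close>, and read them as digits in a base that excludes carries. Along a
  progression of degree \<open>n\<close> the squared norm is a progression of degree \<open>2 n\<close>, hence
  constant, and then so are the digits. Writing the size condition as \<open>N \<le> exp (d ^ (s + 1))\<close>
  and the density as \<open>exp (- C d)\<close> makes the dimension \<open>d\<close> the only parameter.\<close>

section \<open>Finite differences\<close>

definition fdiff :: "(nat \<Rightarrow> 'a::ab_group_add) \<Rightarrow> nat \<Rightarrow> 'a" where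
  "fdiff f j = f (Suc j) - f j"

lemma fdiff_funpow_Suc: "(fdiff ^^ Suc n) f = (fdiff ^^ n) (fdiff f)"
  by (simp add: funpow_swap1)

lemma fdiff_funpow_Suc_apply: "(fdiff ^^ Suc n) f a = (fdiff ^^ n) f (Suc a) - (fdiff ^^ n) f a"
  by (simp add: fdiff_def[of "(fdiff ^^ n) f"])

text \<open>An iterated difference is local. This matters because progressions are only controlled
  at the points below \<open>k\<close>.\<close>

lemma fdiff_funpow_cong:
  assumes "\<And>i. i \<le> n \<Longrightarrow> f (a + i) = g (a + i)"
  shows "(fdiff ^^ n) f a = (fdiff ^^ n) g a"
  using assms
proof (induction n arbitrary: f g)
  case (Suc n)
  have "(fdiff ^^ n) (fdiff f) a = (fdiff ^^ n) (fdiff g) a"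
  proof (rule Suc.IH)
    fix i assume "i \<le> n"
    then show "fdiff f (a + i) = fdiff g (a + i)"
      using Suc.prems[of i] Suc.prems[of "Suc i"] by (simp add: fdiff_def)
  qed
  then show ?case by (simp only: fdiff_funpow_Suc)
qed simp

lemma fdiff_funpow_diff:
  "(fdiff ^^ n) (\<lambda>j. f j - g j) a = (fdiff ^^ n) f a - (fdiff ^^ n) g a"
proof (induction n arbitrary: a)
  case (Suc n)
  then show ?case by (simp add: fdiff_funpow_Suc_apply del: funpow.simps)
qed simp

lemma fdiff_funpow_sum:
  "(fdiff ^^ n) (\<lambda>j. \<Sum>i\<in>I. f i j) a = (\<Sum>i\<in>I. (fdiff ^^ n) (f i) a)"
proof (induction n arbitrary: a)
  case (Suc n)
  then show ?case by (simp add: fdiff_funpow_Suc_apply sum_subtractf del: funpow.simps)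
qed simp

lemma fdiff_funpow_mult_right:
  fixes c :: "'a::ring"
  shows "(fdiff ^^ n) (\<lambda>j. f j * c) a = (fdiff ^^ n) f a * c"
proof (induction n arbitrary: a)
  case (Suc n)
  then show ?case by (simp add: fdiff_funpow_Suc_apply left_diff_distrib del: funpow.simps)
qed simp

lemma fdiff_funpow_of_int:
  "(fdiff ^^ n) (\<lambda>j. of_int (f j)) a = (of_int ((fdiff ^^ n) f a) :: 'a::ring_1)"
proof (induction n arbitrary: a)
  case (Suc n)
  then show ?case by (simp add: fdiff_funpow_Suc_apply del: funpow.simps)
qed simp

lemma abs_fdiff_funpow_le:
  fixes f :: "nat \<Rightarrow> int"
  assumes "\<And>i. i \<le> n \<Longrightarrow> \<bar>f (a + i)\<bar> \<le> c"
  shows "\<bar>(fdiff ^^ n) f a\<bar> \<le> 2 ^ n * c"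
  using assms
proof (induction n arbitrary: a)
  case (Suc n)
  have "\<bar>(fdiff ^^ n) f (Suc a)\<bar> \<le> 2 ^ n * c"
    by (rule Suc.IH) (use Suc.prems[of "Suc _"] in simp)
  moreover have "\<bar>(fdiff ^^ n) f a\<bar> \<le> 2 ^ n * c"
    by (rule Suc.IH) (use Suc.prems in simp)
  ultimately show ?case by (simp add: fdiff_funpow_Suc_apply del: funpow.simps)
qed (use assms[of 0] in simp)

text \<open>In the binomial expansion of the difference, the last value has coefficient 1 and is the
  only one that can be nonzero.\<close>

lemma fdiff_funpow_eq_last:
  assumes "\<And>i. i < n \<Longrightarrow> f (a + i) = 0"
  shows "(fdiff ^^ n) f a = f (a + n)"
  using assms
proof (induction n arbitrary: f)
  case (Suc n)
  have "(fdiff ^^ n) (fdiff f) a = fdiff f (a + n)"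
  proof (rule Suc.IH)
    fix i assume "i < n"
    then show "fdiff f (a + i) = 0"
      using Suc.prems[of i] Suc.prems[of "Suc i"] by (simp add: fdiff_def)
  qed
  then show ?case using Suc.prems[of n] by (simp only: fdiff_funpow_Suc) (simp add: fdiff_def)
qed simp

section \<open>Polynomials of bounded degree and vanishing differences\<close>

lemma degree_shift_diff_le:
  fixes p :: "'a::idom poly"
  assumes "degree p \<le> Suc n"
  shows "degree (pcompose p [:1, 1:] - p) \<le> n"
proof (rule degree_le, intro allI impI)
  fix i assume i: "n < i"
  let ?q = "pcompose p [:1, 1:]"
  have deg: "degree ?q = degree p" by (simp add: degree_pcompose)
  have lead: "lead_coeff ?q = lead_coeff p" by (subst lead_coeff_comp) auto
  show "coeff (?q - p) i = 0"
  proof (cases "i = degree p")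
    case True
    then show ?thesis using deg lead by simp
  next
    case False
    then have "degree p < i" using i assms by simp
    then show ?thesis using deg by (simp add: coeff_eq_0)
  qed
qed

text \<open>Each difference cancels the leading term, since a shift keeps both degree and leading
  coefficient.\<close>

lemma fdiff_funpow_poly:
  fixes p :: "'a::idom poly"
  assumes "degree p \<le> n"
  shows "(fdiff ^^ Suc n) (\<lambda>j. poly p (of_nat j)) a = 0"
  using assms
proof (induction n arbitrary: p)
  case 0
  then obtain c where "p = [:c:]" by (metis degree_eq_zeroE le_zero_eq)
  then show ?case by (simp add: fdiff_def)
next
  case (Suc n)
  have "fdiff (\<lambda>j. poly p (of_nat j)) =
      (\<lambda>j. poly (pcompose p [:1, 1:] - p) (of_nat j))"
    by (rule ext) (simp add: fdiff_def poly_pcompose)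
  then show ?case
    by (subst fdiff_funpow_Suc) (simp only: Suc.IH[OF degree_shift_diff_le[OF Suc.prems]])
qed

text \<open>Newton's scheme: a new node is accommodated by adding a multiple of the product
  \<open>r\<close> that vanishes at all earlier nodes.\<close>

lemma interpolation_exists:
  fixes f :: "nat \<Rightarrow> real"
  shows "\<exists>q. degree q \<le> n \<and> (\<forall>j\<le>n. poly q (real j) = f j)"
proof (induction n)
  case 0
  show ?case by (rule exI[of _ "[:f 0:]"]) simp
next
  case (Suc n)
  then obtain q where q: "degree q \<le> n" "\<And>j. j \<le> n \<Longrightarrow> poly q (real j) = f j" by blast
  define r where "r = (\<Prod>i\<in>{..n}. [:- real i, 1:])"
  have r0: "poly r (real j) = 0" if "j \<le> n" for j
    using that by (auto simp: r_def poly_prod)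
  have r1: "poly r (real (Suc n)) \<noteq> 0"
    by (auto simp: r_def poly_prod)
  have "degree r = Suc n"
    unfolding r_def by (subst degree_prod_eq_sum_degree) auto
  moreover define c where "c = (f (Suc n) - poly q (real (Suc n))) / poly r (real (Suc n))"
  ultimately have "degree (q + smult c r) \<le> Suc n"
    using q(1) by (intro degree_add_le) auto
  moreover have "poly (q + smult c r) (real j) = f j" if "j \<le> Suc n" for j
  proof (cases "j = Suc n")
    case True
    then show ?thesis using r1 by (simp add: c_def)
  next
    case False
    then show ?thesis using that q(2)[of j] r0[of j] by simp
  qed
  ultimately show ?case by blast
qed

text \<open>A converse to \<open>fdiff_funpow_poly\<close> on an initial segment. After subtracting
  the interpolant at \<open>0..n\<close>, the vanishing differences force every later value to be
  zero, one after the other.\<close>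

lemma poly_if_fdiff_zero:
  fixes f :: "nat \<Rightarrow> real"
  assumes "\<And>a. a + Suc n < k \<Longrightarrow> (fdiff ^^ Suc n) f a = 0"
  shows "\<exists>q. degree q \<le> n \<and> (\<forall>j<k. f j = poly q (real j))"
proof -
  obtain q where q: "degree q \<le> n" "\<And>j. j \<le> n \<Longrightarrow> poly q (real j) = f j"
    using interpolation_exists[of n f] by blast
  define g where "g j = f j - poly q (real j)" for j
  have "g j = 0" if "j < k" for j
    using that
  proof (induction j rule: less_induct)
    case (less j)
    show ?case
    proof (cases "j \<le> n")
      case True
      then show ?thesis using q(2) by (simp add: g_def)
    next
      case False
      then obtain a where j: "j = a + Suc n" by (metis not_less_eq_eq le_Suc_ex add.commute)
      have "(fdiff ^^ Suc n) g a = g (a + Suc n)"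
        by (rule fdiff_funpow_eq_last) (use less j in auto)
      moreover have "(fdiff ^^ Suc n) g a = 0"
        unfolding g_def fdiff_funpow_diff
        using assms[of a] fdiff_funpow_poly[OF q(1), of a] less.prems j by simp
      ultimately show ?thesis by (simp add: j)
    qed
  qed
  then show ?thesis using q(1) by (intro exI[of _ q]) (simp add: g_def)
qed

section \<open>Digits and translates\<close>

text \<open>Modulo \<open>b\<close> only \<open>e 0\<close> survives; being smaller than
  \<open>b\<close> in absolute value, it is zero. Dividing by \<open>b\<close> then leaves one digit
  fewer. Signed digits are allowed so that the lemma applies to differences.\<close>

lemma digits_zero:
  fixes e :: "nat \<Rightarrow> int"
  assumes "(\<Sum>i<d. e i * b ^ i) = 0" "\<And>i. i < d \<Longrightarrow> \<bar>e i\<bar> < b" "i < d"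
  shows "e i = 0"
  using assms
proof (induction d arbitrary: e i)
  case (Suc d)
  have split: "(\<Sum>i<Suc d. e i * b ^ i) = e 0 + b * (\<Sum>i<d. e (Suc i) * b ^ i)"
    by (subst sum.lessThan_Suc_shift) (simp add: sum_distrib_left mult_ac)
  then have "b dvd e 0"
    using Suc.prems(1) by (metis add_eq_0_iff dvd_minus_iff dvd_triv_left)
  moreover have "\<bar>e 0\<bar> < b" using Suc.prems(2) by simp
  ultimately have e0: "e 0 = 0" using dvd_imp_le_int by force
  have "b > 0" using Suc.prems(2)[of 0] by simp
  then have "(\<Sum>i<d. e (Suc i) * b ^ i) = 0" using split e0 Suc.prems(1) by simp
  then have "e (Suc i') = 0" if "i' < d" for i'
    using Suc.IH[of "\<lambda>i. e (Suc i)" i'] Suc.prems(2) that by simp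
  with e0 Suc.prems(3) show ?case by (cases i) auto
qed simp

lemma digits_bound:
  fixes x :: "nat \<Rightarrow> nat"
  assumes "\<And>i. i < d \<Longrightarrow> x i < b"
  shows "(\<Sum>i<d. x i * b ^ i) < b ^ d"
  using assms
proof (induction d)
  case (Suc d)
  have "(\<Sum>i<d. x i * b ^ i) < b ^ d" using Suc by simp
  moreover have "Suc (x d) * b ^ d \<le> b * b ^ d"
    using Suc.prems[of d] by (intro mult_right_mono) auto
  ultimately show ?case by simp
qed simp

text \<open>The average over the \<open>2 M\<close> relevant translates: each pair of \<open>x\<close> and \<open>r \<in> R\<close> is counted by
  exactly one of them.\<close>

lemma popular_translate:
  fixes q :: "'a \<Rightarrow> nat"
  assumes "finite X" "\<And>x. x \<in> X \<Longrightarrow> q x \<le> M" "R \<subseteq> {1..M}" "M \<ge> 1"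
  shows "\<exists>t::int. card X * card R \<le> 2 * M * card {x\<in>X. int (q x) + t \<in> int ` R}"
proof (rule ccontr)
  assume "\<not> ?thesis"
  then have less: "2 * M * card {x\<in>X. int (q x) + t \<in> int ` R} < card X * card R" for t
    by (simp add: not_le)
  \<comment> \<open>These translates cover every difference of some \<open>r\<close> in
    \<open>{1..M}\<close> and some \<open>q x\<close> in \<open>{0..M}\<close>.\<close>
  define T where "T = {1 - int M..int M}"
  have T: "finite T" "card T = 2 * M" "T \<noteq> {}"
    using assms(4) by (auto simp: T_def)
  have fib: "card {t\<in>T. int (q x) + t \<in> int ` R} = card R" if "x \<in> X" for x
  proof -
    have "{t\<in>T. int (q x) + t \<in> int ` R} = (\<lambda>r. int r - int (q x)) ` R"
      using assms(2)[OF that] assms(3) by (force simp: T_def image_iff)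
    then show ?thesis by (simp add: card_image inj_on_def)
  qed
  have "(\<Sum>t\<in>T. card {x\<in>X. int (q x) + t \<in> int ` R}) =
      (\<Sum>x\<in>X. card {t\<in>T. int (q x) + t \<in> int ` R})"
    by (rule sum_multicount_gen) (use T(1) assms(1) in auto)
  also have "\<dots> = card X * card R" using fib by simp
  finally have total: "(\<Sum>t\<in>T. card {x\<in>X. int (q x) + t \<in> int ` R}) = card X * card R" .
  have "(\<Sum>t\<in>T. 2 * M * card {x\<in>X. int (q x) + t \<in> int ` R}) < (\<Sum>t\<in>T. card X * card R)"
    using T less by (intro sum_strict_mono) auto
  then show False using total T(2) by (simp flip: sum_distrib_left)
qed

section \<open>Line-free sets from progression-free sets\<close>

lemma finite_words: "finite (words k n)"
  by (simp add: words_def finite_PiE)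

lemma card_words: "card (words k n) = k ^ n"
  by (simp add: words_def card_PiE)

lemma card_le_dhj_number:
  assumes "A \<subseteq> words k n" "line_free k n A"
  shows "card A \<le> dhj_number n k"
proof -
  have "{card A | A. A \<subseteq> words k n \<and> line_free k n A} \<subseteq> card ` Pow (words k n)" by auto
  then have "finite {card A | A. A \<subseteq> words k n \<and> line_free k n A}"
    by (rule finite_subset) (simp add: finite_words)
  then show ?thesis unfolding dhj_number_def by (rule Max_ge) (intro CollectI exI[of _ A] conjI refl assms)
qed

section \<open>Extremal progression-free sets\<close>

lemma finite_ap_free_cards: "finite {card A | A. A \<subseteq> {1..N} \<and> ap_free k A}"
proof -
  have "{card A | A. A \<subseteq> {1..N} \<and> ap_free k A} \<subseteq> card ` Pow {1..N}" by auto
  then show ?thesis by (rule finite_subset) simp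
qed

lemma card_le_ap_free_number:
  assumes "A \<subseteq> {1..N}" "ap_free k A"
  shows "card A \<le> ap_free_number k N"
  unfolding ap_free_number_def by (rule Max_ge[OF finite_ap_free_cards]) (intro CollectI exI[of _ A] conjI refl assms)

lemma ap_free_number_attained:
  assumes "k \<ge> 1"
  obtains A where "A \<subseteq> {1..N}" "ap_free k A" "card A = ap_free_number k N"
proof -
  \<comment> \<open>For \<open>k = 0\<close> the empty progression would lie in every set, hence the
    assumption \<open>k >= 1\<close>.\<close>
  have "ap_free k {}" using assms by (auto simp: ap_free_def lessThan_empty_iff bot_nat_def)
  then have "{card A | A. A \<subseteq> {1..N} \<and> ap_free k A} \<noteq> {}" by blast
  from Max_in[OF finite_ap_free_cards this]
  obtain A where "A \<subseteq> {1..N}" "ap_free k A" "card A = ap_free_number k N"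
    unfolding ap_free_number_def by (elim CollectE exE conjE) simp
  then show thesis by (rule that)
qed

lemma ap_free_number_le:
  assumes "k \<ge> 1"
  shows "ap_free_number k N \<le> N"
proof -
  obtain A where "A \<subseteq> {1..N}" "card A = ap_free_number k N"
    using ap_free_number_attained[OF assms] by blast
  then show ?thesis using card_mono[of "{1..N}" A] by simp
qed

text \<open>Each active column contributes \<open>i\<close> to the sum of row \<open>i\<close>, and
  all other columns together contribute a constant. So \<open>d\<close> is the number of active
  columns, which is positive because the rows are distinct.\<close>

lemma line_sums:
  assumes "combinatorial_line k n L" "k \<ge> 2"
  shows "\<exists>row a d. L = row ` {1..k} \<and> d > 0 \<and>
    (\<forall>i\<in>{1..k}. (\<Sum>j\<in>{1..n}. row i j) = a + i * d)"
proof -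
  from assms(1) obtain row where row: "L = row ` {1..k}" "inj_on row {1..k}"
      "row ` {1..k} \<subseteq> words k n"
    and cols: "\<forall>j\<in>{1..n}.
      (\<exists>x\<in>{1..k}. \<forall>i\<in>{1..k}. row i j = x) \<or> (\<forall>i\<in>{1..k}. row i j = i)"
    unfolding combinatorial_line_def by (elim exE conjE)
  define V where "V = {j\<in>{1..n}. \<forall>i\<in>{1..k}. row i j = i}"
  have one: "1 \<in> {1..k}" "2 \<in> {1..k}" using assms(2) by auto
  have const: "row i j = row 1 j" if j: "j \<in> {1..n} - V" and i: "i \<in> {1..k}" for i j
    proof -
    have "\<not> (\<forall>i\<in>{1..k}. row i j = i)" using that(1) unfolding V_def by blast
    then obtain x where "\<forall>i\<in>{1..k}. row i j = x" using bspec[OF cols, of j] j by blast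
    then show ?thesis using i one(1) by metis
  qed
  \<comment> \<open>Without active columns rows 1 and 2 would coincide, against injectivity.\<close>
  have "V \<noteq> {}"
  proof
    assume "V = {}"
    then have "row 2 j = row 1 j" if "j \<in> {1..n}" for j
      using const[of j 2] one that by simp
    moreover have "row 1 \<in> {1..n} \<rightarrow>\<^sub>E {1..k}" "row 2 \<in> {1..n} \<rightarrow>\<^sub>E {1..k}"
      using row(3) one unfolding words_def by blast+
    ultimately have "row 2 = row 1" by (metis PiE_ext)
    then show False using inj_onD[OF row(2), of 2 1] one by simp
  qed
  moreover have "finite V" by (simp add: V_def)
  ultimately have "card V > 0" by (simp add: card_gt_0_iff)
  moreover have "(\<Sum>j\<in>{1..n}. row i j) = (\<Sum>j\<in>{1..n} - V. row 1 j) + i * card V"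
    if "i \<in> {1..k}" for i
  proof -
    have "(\<Sum>j\<in>{1..n}. row i j) = (\<Sum>j\<in>{1..n} - V. row i j) + (\<Sum>j\<in>V. row i j)"
      by (rule sum.subset_diff) (auto simp: V_def)
    moreover have "(\<Sum>j\<in>V. row i j) = i * card V"
      using that by (simp add: V_def)
    moreover have "(\<Sum>j\<in>{1..n} - V. row i j) = (\<Sum>j\<in>{1..n} - V. row 1 j)"
      by (intro sum.cong refl const that)
    ultimately show ?thesis by simp
  qed
  ultimately show ?thesis using row(1) by blast
qed

text \<open>Coordinate sums are at most \<open>k * n\<close>, so the average is over
  \<open>2 * (k * n)\<close> translates of an extremal set; this is the source of that
  factor.\<close>

lemma dhj_number_ge:
  assumes "k \<ge> 2" "n \<ge> 1"
  shows "k ^ n * ap_free_number k (k * n) \<le> 2 * (k * n) * dhj_number n k"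
proof -
  obtain R where R: "R \<subseteq> {1..k * n}" "ap_free k R" "card R = ap_free_number k (k * n)"
    using ap_free_number_attained[of k "k * n"] assms(1) by auto
  define \<sigma> where "\<sigma> w = (\<Sum>j\<in>{1..n}. w j)" for w :: "nat \<Rightarrow> nat"
  have "\<sigma> w \<le> k * n" if "w \<in> words k n" for w
  proof -
    have "\<sigma> w \<le> (\<Sum>j\<in>{1..n}. k)"
      unfolding \<sigma>_def using that by (intro sum_mono) (auto simp: words_def)
    then show ?thesis by (simp add: mult.commute)
  qed
  then obtain t where t: "card (words k n) * card R \<le>
      2 * (k * n) * card {w\<in>words k n. int (\<sigma> w) + t \<in> int ` R}"
    using popular_translate[OF finite_words _ R(1), of k n \<sigma>] assms by auto
  define A where "A = {w\<in>words k n. int (\<sigma> w) + t \<in> int ` R}"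
  have "line_free k n A"
    unfolding line_free_def
  proof
    assume "\<exists>L. L \<subseteq> A \<and> combinatorial_line k n L"
    then obtain L where L: "L \<subseteq> A" "combinatorial_line k n L" by blast
    from line_sums[OF L(2) assms(1)]
    obtain row a d where row: "L = row ` {1..k}" and d: "d > 0"
      and sums: "\<forall>i\<in>{1..k}. (\<Sum>j\<in>{1..n}. row i j) = a + i * d"
      by (elim exE conjE)
    have mem: "int (a + i * d) + t \<in> int ` R" if "i \<in> {1..k}" for i
    proof -
      have "row i \<in> A" using L(1) that unfolding row by blast
      then show ?thesis using bspec[OF sums that] by (simp add: A_def \<sigma>_def del: of_nat_sum)
    qed
    have "int (a + 1 * d) + t \<in> int ` R" by (rule mem) (use assms(1) in simp)
    then obtain b where b: "int (a + 1 * d) + t = int b" by (elim imageE)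
    have "b + i * d \<in> R" if "i < k" for i
    proof -
      have "int (a + Suc i * d) + t = int (b + i * d)" using b by (simp add: algebra_simps)
      moreover have "int (a + Suc i * d) + t \<in> int ` R" by (rule mem) (use that in simp)
      ultimately show ?thesis by (simp only: inj_image_mem_iff[OF inj_of_nat])
    qed
    then have "(\<lambda>i. b + i * d) ` {..<k} \<subseteq> R" by auto
    then show False using R(2) d unfolding ap_free_def by metis
  qed
  then have "card A \<le> dhj_number n k" by (intro card_le_dhj_number) (auto simp: A_def)
  then have "2 * (k * n) * card A \<le> 2 * (k * n) * dhj_number n k" by (rule mult_le_mono2)
  with t show ?thesis unfolding card_words R(3) A_def by (rule order_trans)
qed

section \<open>Sets without polynomial progressions\<close>

text \<open>Progressions of degree at most \<open>n\<close> with \<open>k\<close> terms are all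
  constant. Real coefficients are allowed since the digit polynomials come from interpolation and
  need not be integral.\<close>

definition poly_free :: "nat \<Rightarrow> nat \<Rightarrow> nat set \<Rightarrow> bool" where
  "poly_free k n A \<longleftrightarrow> (\<forall>p :: real poly. degree p \<le> n \<longrightarrow>
     (\<forall>j<k. poly p (real j) \<in> real ` A) \<longrightarrow> (\<forall>j<k. poly p (real j) = poly p 0))"

lemma poly_free_singleton: "poly_free k n {a}"
  unfolding poly_free_def
proof (intro allI impI)
  fix p :: "real poly" and j
  assume "\<forall>j<k. poly p (real j) \<in> real ` {a}" and "j < k"
  then have "poly p (real j) = real a" "poly p (real 0) = real a" by blast+
  then show "poly p (real j) = poly p 0" by simp
qed

lemma ap_free_if_poly_free:
  assumes "poly_free k 1 A" "k \<ge> 2"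
  shows "ap_free k A"
  unfolding ap_free_def
proof
  assume "\<exists>a d. 0 < d \<and> (\<lambda>i. a + i * d) ` {..<k} \<subseteq> A"
  then obtain a d where d: "d > 0" and A: "(\<lambda>i. a + i * d) ` {..<k} \<subseteq> A" by blast
  let ?p = "[:real a, real d:]"
  have eq: "poly ?p (real j) = real (a + j * d)" for j by simp
  have "degree ?p \<le> 1" by simp
  moreover have "\<forall>j<k. poly ?p (real j) \<in> real ` A"
    unfolding eq using A by blast
  ultimately have "\<forall>j<k. poly ?p (real j) = poly ?p 0"
    using assms(1) unfolding poly_free_def by blast
  then have "poly ?p (real 1) = poly ?p 0" using assms(2) by (metis less_eq_Suc_le Suc_1)
  then show False using d by simp
qed

text \<open>In the convolution every term but \<open>i = n\<close> has an index above the degree. As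
  \<open>n\<close> may exceed the degree, several polynomials can be compared at their maximal
  degree.\<close>

lemma coeff_square_twice_degree:
  fixes p :: "'a::comm_semiring_1 poly"
  assumes "degree p \<le> n"
  shows "coeff (p ^ 2) (2 * n) = (coeff p n) ^ 2"
proof -
  have "coeff (p ^ 2) (2 * n) = (\<Sum>i\<le>2 * n. coeff p i * coeff p (2 * n - i))"
    by (simp add: power2_eq_square coeff_mult)
  also have "\<dots> = (\<Sum>i\<in>{n}. coeff p i * coeff p (2 * n - i))"
  proof (rule sum.mono_neutral_right)
    show "\<forall>i\<in>{..2 * n} - {n}. coeff p i * coeff p (2 * n - i) = 0"
    proof
      fix i assume "i \<in> {..2 * n} - {n}"
      then have "n < i \<or> n < 2 * n - i" by auto
      then show "coeff p i * coeff p (2 * n - i) = 0"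
        using assms by (auto simp: coeff_eq_0)
    qed
  qed auto
  also have "\<dots> = (coeff p n) ^ 2" by (simp add: power2_eq_square)
  finally show ?thesis .
qed

text \<open>The leading coefficients of squares of real polynomials are positive, so they cannot cancel.\<close>

lemma degree_sum_squares_zero:
  fixes p :: "'a \<Rightarrow> real poly"
  assumes "finite I" "degree (\<Sum>i\<in>I. p i ^ 2) = 0" "i \<in> I"
  shows "degree (p i) = 0"
proof (rule ccontr)
  assume "degree (p i) \<noteq> 0"
  define e where "e = Max ((\<lambda>i. degree (p i)) ` I)"
  have le: "degree (p j) \<le> e" if "j \<in> I" for j
    unfolding e_def using assms(1) that by auto
  have "e > 0" using le[OF assms(3)] \<open>degree (p i) \<noteq> 0\<close> by simp
  have "e \<in> (\<lambda>i. degree (p i)) ` I"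
    unfolding e_def using assms(1,3) by (intro Max_in) auto
  then obtain l where l: "l \<in> I" "degree (p l) = e" by auto
  have "coeff (\<Sum>i\<in>I. p i ^ 2) (2 * e) = 0"
    using assms(2) \<open>e > 0\<close> by (intro coeff_eq_0) simp
  then have "(\<Sum>j\<in>I. (coeff (p j) e) ^ 2) = 0"
    using le by (simp add: coeff_sum coeff_square_twice_degree)
  then have "coeff (p l) e = 0"
    using assms(1) l(1) by (simp add: sum_nonneg_eq_0_iff)
  then have "p l = 0" using l(2) by auto
  then show False using l(2) \<open>e > 0\<close> by simp
qed

text \<open>A polynomial progression of numbers whose base \<open>b\<close> digits are small does not produce carries,
  so that the digits themselves form polynomial progressions.\<close>

lemma digits_polynomial:
  fixes x :: "nat \<Rightarrow> nat \<Rightarrow> nat" and p :: "real poly"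
  assumes deg: "degree p \<le> n"
    and val: "\<And>j. j < k \<Longrightarrow> poly p (real j) = real (Suc (\<Sum>i<d. x j i * b ^ i))"
    and bound: "\<And>j i. j < k \<Longrightarrow> i < d \<Longrightarrow> x j i < m"
    and b: "b = 2 ^ Suc n * m" and i: "i < d"
  shows "\<exists>q. degree q \<le> n \<and> (\<forall>j<k. real (x j i) = poly q (real j))"
proof (rule poly_if_fdiff_zero)
  fix a assume a: "a + Suc n < k"
  define y where "y i j = int (x j i)" for i j
  define e where "e i = (fdiff ^^ Suc n) (y i) a" for i
  let ?p = "p - [:1:]"
  \<comment> \<open>Subtracting 1 undoes the \<open>Suc\<close> that moves the digit sums into the
    positive integers.\<close>
  have "degree ?p \<le> n" using deg by (intro degree_diff_le) auto
  then have "0 = (fdiff ^^ Suc n) (\<lambda>j. poly ?p (real j)) a"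
    by (rule fdiff_funpow_poly[symmetric])
  also have "\<dots> = (fdiff ^^ Suc n) (\<lambda>j. of_int (\<Sum>i<d. y i j * int b ^ i)) a"
  proof (rule fdiff_funpow_cong)
    fix l assume "l \<le> Suc n"
    then have "a + l < k" using a by simp
    then show "poly ?p (real (a + l)) = of_int (\<Sum>i<d. y i (a + l) * int b ^ i)"
      using val[of "a + l"] by (simp add: y_def)
  qed
  also have "\<dots> = of_int (\<Sum>i<d. e i * int b ^ i)"
    unfolding fdiff_funpow_of_int fdiff_funpow_sum fdiff_funpow_mult_right e_def ..
  finally have zero: "(\<Sum>i<d. e i * int b ^ i) = 0" by (metis of_int_0_eq_iff)
  have small: "\<bar>e i'\<bar> < int b" if "i' < d" for i'
  proof -
    have "x a i' < m" using bound[of a i'] a that by simp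
    then have "m \<ge> 1" by simp
    \<comment> \<open>Each of the \<open>Suc n\<close> differences at most doubles the bound
      \<open>m - 1\<close>; the factor \<open>2 ^ Suc n\<close> in the base absorbs this.\<close>
    have "\<bar>e i'\<bar> \<le> 2 ^ Suc n * (int m - 1)"
      unfolding e_def
    proof (rule abs_fdiff_funpow_le)
      fix l assume "l \<le> Suc n"
      then show "\<bar>y i' (a + l)\<bar> \<le> int m - 1"
        using bound[of "a + l" i'] a that by (simp add: y_def)
    qed
    also have "\<dots> < int b" by (simp add: b algebra_simps)
    finally show ?thesis .
  qed
  have "e i = 0" by (rule digits_zero[OF zero small i])
  moreover have "(fdiff ^^ Suc n) (\<lambda>j. real (x j i)) a = of_int (e i)"
    unfolding e_def fdiff_funpow_of_int[symmetric] by (simp only: y_def of_int_of_nat_eq)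
  ultimately show "(fdiff ^^ Suc n) (\<lambda>j. real (x j i)) a = 0" by simp
qed

lemma inj_on_digits:
  fixes b :: nat
  assumes "m \<le> b"
  shows "inj_on (\<lambda>x. Suc (\<Sum>i<d. x i * b ^ i)) ({..<d} \<rightarrow>\<^sub>E {..<m})"
proof (rule inj_onI)
  fix x y assume x: "x \<in> {..<d} \<rightarrow>\<^sub>E {..<m}" and y: "y \<in> {..<d} \<rightarrow>\<^sub>E {..<m}"
    and "Suc (\<Sum>i<d. x i * b ^ i) = Suc (\<Sum>i<d. y i * b ^ i)"
  then have "int (\<Sum>i<d. x i * b ^ i) = int (\<Sum>i<d. y i * b ^ i)" by simp
  then have zero: "(\<Sum>i<d. (int (x i) - int (y i)) * int b ^ i) = 0"
    by (simp add: left_diff_distrib sum_subtractf)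
  have small: "\<bar>int (x i) - int (y i)\<bar> < int b" if "i < d" for i
  proof -
    have "x i < m" "y i < m" using x y that by (auto dest: PiE_mem)
    then show ?thesis using assms by linarith
  qed
  show "x = y"
  proof (rule PiE_ext[OF x y])
    fix i assume "i \<in> {..<d}"
    then have "int (x i) - int (y i) = 0" by (intro digits_zero[OF zero small]) auto
    then show "x i = y i" by simp
  qed
qed

text \<open>The digits along a progression are polynomials of degree at most \<open>n\<close>, so
  their translated squared norm has degree at most \<open>2 * n\<close> and takes values in
  \<open>R\<close>. It is therefore constant, and a constant sum of real squares has constant
  summands.\<close>

lemma poly_free_sphere:
  fixes m n k d :: nat and R :: "nat set" and t :: int
  assumes R: "poly_free k (2 * n) R" and k: "k > 2 * n"
    and b: "b = 2 ^ Suc n * m"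
    and S: "S \<subseteq> {x \<in> {..<d} \<rightarrow>\<^sub>E {..<m}. int (\<Sum>i<d. x i ^ 2) + t \<in> int ` R}"
  shows "poly_free k n ((\<lambda>x. Suc (\<Sum>i<d. x i * b ^ i)) ` S)"
  unfolding poly_free_def
proof (intro allI impI)
  let ?\<phi> = "\<lambda>x :: nat \<Rightarrow> nat. Suc (\<Sum>i<d. x i * b ^ i)"
  fix p :: "real poly" and j'
  assume deg: "degree p \<le> n" and mem: "\<forall>j<k. poly p (real j) \<in> real ` ?\<phi> ` S" and j': "j' < k"
  have "\<forall>j. \<exists>x. j < k \<longrightarrow> x \<in> S \<and> poly p (real j) = real (?\<phi> x)"
  proof
    fix j
    show "\<exists>x. j < k \<longrightarrow> x \<in> S \<and> poly p (real j) = real (?\<phi> x)"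
    proof (cases "j < k")
      case True
      then have "poly p (real j) \<in> real ` ?\<phi> ` S" using mem by blast
      then show ?thesis by (elim imageE) auto
    qed simp
  qed
  then obtain x where x: "\<And>j. j < k \<Longrightarrow> x j \<in> S"
    and val: "\<And>j. j < k \<Longrightarrow> poly p (real j) = real (?\<phi> (x j))"
    by metis
  have bound: "x j i < m" if "j < k" "i < d" for j i
    using x[OF that(1)] that(2) S by (auto dest: PiE_mem)
  have "\<forall>i. \<exists>q. i < d \<longrightarrow> degree q \<le> n \<and> (\<forall>j<k. real (x j i) = poly q (real j))"
    using digits_polynomial[OF deg val bound b] by blast
  then obtain q where q: "\<And>i. i < d \<Longrightarrow> degree (q i) \<le> n"
    "\<And>i j. i < d \<Longrightarrow> j < k \<Longrightarrow> real (x j i) = poly (q i) (real j)"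
    by metis
  define P where "P = (\<Sum>i<d. q i ^ 2) + [:of_int t:]"
  have "degree (q i ^ 2) \<le> 2 * n" if "i < d" for i
    using degree_power_le[of "q i" 2] q(1)[OF that] by simp
  then have degP: "degree P \<le> 2 * n"
    unfolding P_def by (intro degree_add_le degree_sum_le) auto
  have "poly P (real j) \<in> real ` R" if j: "j < k" for j
  proof -
    obtain r where r: "r \<in> R" "int (\<Sum>i<d. x j i ^ 2) + t = int r"
      using x[OF j] S by blast
    have "poly P (real j) = (\<Sum>i<d. real (x j i) ^ 2) + of_int t"
      using q(2) j by (simp add: P_def poly_sum)
    also have "\<dots> = of_int (int (\<Sum>i<d. x j i ^ 2) + t)" by simp
    also have "\<dots> = real r" unfolding r(2) by simp
    finally show ?thesis using r(1) by blast
  qed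
  then have const: "\<forall>j<k. poly P (real j) = poly P 0"
    using R degP unfolding poly_free_def by blast
  \<comment> \<open>Constancy at \<open>k > 2 * n\<close> points is upgraded to an identity of
    polynomials.\<close>
  have "P = [:poly P 0:]"
  proof (rule poly_eqI_degree)
    show "poly P y = poly [:poly P 0:] y" if "y \<in> real ` {..<k}" for y
      using const that by auto
    show "degree P < card (real ` {..<k})" "degree [:poly P 0:] < card (real ` {..<k})"
      using degP k by (auto simp: card_image)
  qed
  then have "degree P = 0" by (metis degree_pCons_0)
  moreover have "(\<Sum>i<d. q i ^ 2) = P - [:of_int t:]" by (simp add: P_def)
  ultimately have "degree (\<Sum>i<d. q i ^ 2) = 0"
    using degree_diff_le[of P 0 "[:of_int t:]"] by simp
  then have "degree (q i) = 0" if "i < d" for i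
    using degree_sum_squares_zero[of "{..<d}" q i] that by simp
  then have "poly (q i) (real j') = poly (q i) (real 0)" if "i < d" for i
    using degree_eq_zeroE[of "q i"] that by (metis mult_zero_right poly_0 poly_pCons)
  then have "x j' i = x 0 i" if "i < d" for i
    using q(2)[OF that j'] q(2)[OF that, of 0] that j' by (metis gr_implies_not0 not_gr0 of_nat_eq_iff)
  then have "?\<phi> (x j') = ?\<phi> (x 0)" by simp
  then have "poly p (real j') = poly p (real 0)"
    using val[OF j'] val[of 0] j' by (metis gr_implies_not0 not_gr0)
  then show "poly p (real j') = poly p 0" by simp
qed

text \<open>Squared norms are at most \<open>d * m ^ 2\<close>, so some translate of
  \<open>R\<close> captures at least the proportion \<open>card R / (2 * (d * m ^ 2))\<close> of the
  \<open>m ^ d\<close> vectors. The condition on \<open>N\<close> makes room for all numbers with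
  \<open>d\<close> digits in the chosen base.\<close>

lemma rankin_step:
  fixes m n k d :: nat and R :: "nat set"
  assumes R: "poly_free k (2 * n) R" "R \<subseteq> {1..d * m ^ 2}" and k: "k > 2 * n"
    and dm: "d \<ge> 1" "m \<ge> 1" and N: "(2 ^ Suc n * m) ^ d \<le> N"
  shows "\<exists>A\<subseteq>{1..N}. poly_free k n A \<and> m ^ d * card R \<le> 2 * (d * m ^ 2) * card A"
proof -
  define b where "b = 2 ^ Suc n * m"
  define X where "X = ({..<d} \<rightarrow>\<^sub>E {..<m})"
  define q where "q x = (\<Sum>i<d. x i ^ 2)" for x :: "nat \<Rightarrow> nat"
  define \<phi> where "\<phi> x = Suc (\<Sum>i<d. x i * b ^ i)" for x :: "nat \<Rightarrow> nat"
  have "m \<le> b" by (simp add: b_def)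
  have X: "finite X" "card X = m ^ d" by (simp_all add: X_def finite_PiE card_PiE)
  have lt: "x i < m" if "x \<in> X" "i < d" for x i
    using that by (auto simp: X_def dest: PiE_mem)
  have "q x \<le> d * m ^ 2" if "x \<in> X" for x
  proof -
    have "q x \<le> (\<Sum>i<d. m ^ 2)"
      unfolding q_def using lt[OF that] by (intro sum_mono power_mono) (auto intro: less_imp_le)
    then show ?thesis by simp
  qed
  then obtain t where t: "card X * card R \<le>
      2 * (d * m ^ 2) * card {x\<in>X. int (q x) + t \<in> int ` R}"
    using popular_translate[OF X(1) _ R(2), of q] dm by auto
  define S where "S = {x\<in>X. int (q x) + t \<in> int ` R}"
  have "\<phi> x \<in> {1..N}" if "x \<in> S" for x
  proof -
    have "(\<Sum>i<d. x i * b ^ i) < b ^ d"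
      using lt that \<open>m \<le> b\<close> by (intro digits_bound) (auto simp: S_def intro: less_le_trans)
    then show ?thesis using N by (simp add: \<phi>_def b_def)
  qed
  moreover have "poly_free k n (\<phi> ` S)"
    unfolding \<phi>_def by (rule poly_free_sphere[OF R(1) k b_def]) (auto simp: S_def X_def q_def)
  moreover have "card (\<phi> ` S) = card S"
    using inj_on_subset[OF inj_on_digits[OF \<open>m \<le> b\<close>, of d], of S]
    by (intro card_image) (auto simp: \<phi>_def[abs_def] S_def X_def)
  ultimately show ?thesis
    using t X(2) by (intro exI[of _ "\<phi> ` S"]) (auto simp: S_def)
qed

text \<open>\<open>C\<close> is independent of \<open>d\<close> and \<open>N\<close>. A singleton
  settles \<open>s = 0\<close>; the step from \<open>s\<close> to \<open>Suc s\<close> uses the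
  induction hypothesis with degree \<open>2 * n\<close> and parameter \<open>3 * d\<close>.\<close>

lemma rankin:
  assumes "k > 2 ^ s * n"
  shows "\<exists>C>0. \<forall>d\<ge>1. \<forall>N\<ge>1. real N \<le> exp (real d ^ Suc s) \<longrightarrow>
    (\<exists>A\<subseteq>{1..N}. poly_free k n A \<and> real N * exp (- C * real d) \<le> real (card A))"
  using assms
proof (induction s arbitrary: n)
  case 0
  show ?case
  proof (intro exI[of _ 1] conjI allI impI)
    fix d N :: nat
    assume "d \<ge> 1" "N \<ge> 1" and N: "real N \<le> exp (real d ^ Suc 0)"
    then have "real N * exp (- 1 * real d) \<le> exp (real d) * exp (- real d)"
      by (intro mult_mono) auto
    also have "\<dots> = real (card {1::nat})" by (simp flip: exp_add)
    finally show "\<exists>A\<subseteq>{1..N}. poly_free k n A \<and> real N * exp (- 1 * real d) \<le> real (card A)"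
      using \<open>N \<ge> 1\<close> poly_free_singleton by (intro exI[of _ "{1}"]) auto
  qed simp
next
  case (Suc s)
  then have "k > 2 ^ s * (2 * n)" by (simp add: mult_ac)
  from Suc.IH[OF this] obtain C where C: "C > 0" and IH: "\<And>d N. d \<ge> 1 \<Longrightarrow> N \<ge> 1 \<Longrightarrow>
      real N \<le> exp (real d ^ Suc s) \<Longrightarrow> \<exists>A\<subseteq>{1..N}. poly_free k (2 * n) A \<and>
        real N * exp (- C * real d) \<le> real (card A)"
    by blast
  have "2 * n \<le> 2 ^ s * (2 * n)" by simp
  then have k: "k > 2 * n" using \<open>k > 2 ^ s * (2 * n)\<close> by linarith
  define c :: nat where "c = 2 ^ Suc n"
  have c: "c \<ge> 1" by (simp add: c_def)
  \<comment> \<open>\<open>3 * C\<close> pays for the parameter \<open>3 * d\<close>,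
    \<open>ln (2 * real c)\<close> for the base factor \<open>c\<close> and the rounding of
    \<open>m\<close>, and 1 for the factor 2 lost to translates.\<close>
  define C' where "C' = 3 * C + ln (2 * real c) + 1"
  have "ln (2 * real c) \<ge> 0" using c by simp
  then have C': "C' > 0" using C by (simp add: C'_def)
  show ?case
  proof (intro exI[of _ C'] conjI allI impI C')
    fix d N :: nat
    assume d: "d \<ge> 1" and N: "N \<ge> 1" and le: "real N \<le> exp (real d ^ Suc (Suc s))"
    \<comment> \<open>The largest digit range for which \<open>(c * m) ^ d\<close> still fits below
      \<open>N\<close>.\<close>
    define m where "m = nat \<lfloor>root d (real N) / real c\<rfloor>"
    have root: "root d (real N) ^ d = real N" using d by (simp add: real_root_pow_pos2)
    have root0: "root d (real N) \<ge> 0" using d by simp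
    have "root d (real N) / real c < real m + 1"
      unfolding m_def using root0 by linarith
    then have ub: "root d (real N) < real c * (real m + 1)"
      using c by (simp add: field_simps)
    have "real m \<le> root d (real N) / real c"
      unfolding m_def using root0 c by (simp add: of_nat_nat)
    then have lb: "real c * real m \<le> root d (real N)"
      using c by (simp add: field_simps)
    have Nub: "real N \<le> (real c * (real m + 1)) ^ d"
      using power_mono[OF less_imp_le[OF ub] root0, of d] root by simp
    have expln: "exp (- ln (2 * real c) * real d) = inverse ((2 * real c) ^ d)"
      using c by (simp add: exp_minus exp_of_nat2_mult)
    show "\<exists>A\<subseteq>{1..N}. poly_free k n A \<and> real N * exp (- C' * real d) \<le> real (card A)"
    \<comment> \<open>If no digit fits, \<open>N\<close> is at most exponential in \<open>d\<close>
      and a singleton is dense enough.\<close>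
    proof (cases "m = 0")
      case True
      then have "real N \<le> (2 * real c) ^ d"
        using order_trans[OF Nub power_mono[of _ "2 * real c" d]] by simp
      moreover have "exp (- C' * real d) \<le> exp (- ln (2 * real c) * real d)"
        unfolding exp_le_cancel_iff using C by (intro mult_right_mono) (auto simp: C'_def)
      ultimately have "real N * exp (- C' * real d) \<le> (2 * real c) ^ d * inverse ((2 * real c) ^ d)"
        unfolding expln by (intro mult_mono) auto
      also have "\<dots> = real (card {1::nat})" using c by (simp add: field_simps)
      finally show ?thesis
        using N poly_free_singleton by (intro exI[of _ "{1}"]) auto
    next
      case False
      then have m: "m \<ge> 1" by simp
      define M where "M = d * m ^ 2"
      have M: "M \<ge> 1" using d m by (simp add: M_def)
      have cm: "(real c * real m) ^ d \<le> real N"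
        using power_mono[OF lb, of d] root by simp
      also have "\<dots> \<le> exp (real d ^ Suc s) ^ d"
        using le by (simp add: exp_of_nat_mult[symmetric] mult_ac)
      finally have "real c * real m \<le> exp (real d ^ Suc s)"
        using d by (subst (asm) power_mono_iff) auto
      moreover have "1 * real m \<le> real c * real m" using c by (intro mult_right_mono) auto
      ultimately have "real m \<le> exp (real d ^ Suc s)" by linarith
      then have "real m ^ 2 \<le> exp (real d ^ Suc s) ^ 2" by (intro power_mono) auto
      moreover have "real d \<le> exp (real d ^ Suc s)"
      proof -
        have "real d ^ 1 \<le> real d ^ Suc s" using d by (intro power_increasing) auto
        then show ?thesis using exp_ge_add_one_self[of "real d ^ Suc s"] unfolding power_one_right by linarith
      qed
      ultimately have "real M \<le> exp (real d ^ Suc s) * exp (real d ^ Suc s) ^ 2"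
        unfolding M_def of_nat_mult of_nat_power by (intro mult_mono) auto
      also have "\<dots> = exp (3 * real d ^ Suc s)"
        by (simp add: power2_eq_square flip: exp_add)
      \<comment> \<open>The factor 3 moves inside the power, which gives the size condition of the
        induction hypothesis for \<open>3 * d\<close>.\<close>
      also have "3 * real d ^ Suc s \<le> real (3 * d) ^ Suc s"
      proof -
        have "(3::real) ^ 1 \<le> 3 ^ Suc s" by (intro power_increasing) auto
        then have "3 * real d ^ Suc s \<le> 3 ^ Suc s * real d ^ Suc s" by (intro mult_right_mono) auto
        also have "\<dots> = real (3 * d) ^ Suc s" by (simp only: power_mult_distrib of_nat_mult of_nat_numeral)
        finally show ?thesis .
      qed
      finally have "real M \<le> exp (real (3 * d) ^ Suc s)" by simp
      from IH[OF _ M this] d obtain R where R: "R \<subseteq> {1..M}" "poly_free k (2 * n) R"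
        and cardR: "real M * exp (- C * real (3 * d)) \<le> real (card R)" by auto
      have "real ((c * m) ^ d) \<le> real N" using cm by simp
      then have "(c * m) ^ d \<le> N" by (simp only: of_nat_le_iff)
      from rankin_step[OF R(2) R(1)[unfolded M_def] k d m this[unfolded c_def]]
      obtain A where A: "A \<subseteq> {1..N}" "poly_free k n A"
        and cardA: "m ^ d * card R \<le> 2 * M * card A"
        unfolding M_def by blast
      have "real m ^ d * (real M * exp (- C * real (3 * d))) \<le> real m ^ d * real (card R)"
        using cardR by (intro mult_left_mono) auto
      also have "real m ^ d * real (card R) = real (m ^ d * card R)" by simp
      also have "\<dots> \<le> real (2 * M * card A)" using cardA by (simp only: of_nat_le_iff)
      also have "\<dots> = 2 * real M * real (card A)" by simp
      finally have "real M * (real m ^ d * exp (- C * real (3 * d))) \<le> real M * (2 * real (card A))"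
        by (simp add: mult_ac)
      then have A1: "real m ^ d * exp (- C * real (3 * d)) \<le> 2 * real (card A)"
        using M by (subst (asm) mult_le_cancel_left_pos) auto
      \<comment> \<open>Rounding costs at most a factor 2 per digit, since
        \<open>m + 1 <= 2 * m\<close>.\<close>
      have "real c * (real m + 1) \<le> 2 * real c * real m"
        using m c by (simp add: algebra_simps)
      then have "real N \<le> (2 * real c * real m) ^ d"
        using order_trans[OF Nub power_mono[of _ "2 * real c * real m" d]] by simp
      then have "real N * inverse ((2 * real c) ^ d) \<le> real m ^ d"
        using c by (simp add: power_mult_distrib field_simps)
      then have A2: "real N * exp (- ln (2 * real c) * real d) \<le> real m ^ d"
        by (simp only: expln)
      have "exp (- real d) \<le> exp (- 1)" using d by simp
      also have "\<dots> \<le> 1 / 2" using exp_ge_add_one_self[of 1] by (simp add: exp_minus field_simps)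
      finally have half: "exp (- real d) \<le> 1 / 2" .
      have "real N * exp (- C' * real d) =
          real N * exp (- ln (2 * real c) * real d) * exp (- C * real (3 * d)) * exp (- real d)"
        by (simp add: C'_def algebra_simps flip: exp_add)
      also have "\<dots> \<le> real m ^ d * exp (- C * real (3 * d)) * (1 / 2)"
        using A2 half by (intro mult_mono) auto
      also have "\<dots> \<le> real (card A)" using A1 by simp
      finally show ?thesis using A by blast
    qed
  qed
qed

section \<open>Asymptotics\<close>

text \<open>One less than a ceiling is strictly below the number, also when \<open>k\<close> is a
  power of 2. This permits \<open>rankin\<close> with \<open>n = 1\<close> and \<open>s\<close> one
  less than the ceiling.\<close>

lemma two_power_ceiling_log_less:
  fixes k :: nat
  assumes "k \<ge> 2"
  shows "nat \<lceil>log 2 (real k)\<rceil> \<ge> 1" "2 ^ (nat \<lceil>log 2 (real k)\<rceil> - 1) < k"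
proof -
  let ?L = "nat \<lceil>log 2 (real k)\<rceil>"
  have "log 2 (real k) > 0" using assms by simp
  then show L: "?L \<ge> 1" by linarith
  have "real (?L - 1) < log 2 (real k)" using L by linarith
  then have "2 powr real (?L - 1) < real k" using assms by (simp add: less_log_iff)
  then have "real (2 ^ (?L - 1)) < real k" by (simp add: powr_realpow)
  then show "2 ^ (?L - 1) < k" by (simp only: of_nat_less_iff)
qed

lemma ap_free_number_pos:
  assumes "k \<ge> 2" "N \<ge> 1"
  shows "ap_free_number k N > 0"
  using card_le_ap_free_number[of "{1}" N k] ap_free_if_poly_free[OF poly_free_singleton assms(1)]
    assms(2) by auto

text \<open>Rankin's bound with \<open>d\<close> the rounded-up \<open>L\<close>-th root of
  \<open>ln N\<close>, put in the form in which the exponent of the theorem needs it. The factor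
  \<open>2 * ln N\<close> is absorbed into the exponential.\<close>

lemma ap_free_number_lower_bound:
  assumes "k \<ge> 2"
  defines "L \<equiv> nat \<lceil>log 2 (real k)\<rceil>"
  shows "\<exists>K>0. \<forall>N\<ge>3. (ln (2 * (real N * ln (real N)) / real (ap_free_number k N))) ^ L
    \<le> K * ln (real N)"
proof -
  have L: "L \<ge> 1" "2 ^ (L - 1) * 1 < k"
    using two_power_ceiling_log_less[OF assms(1)] by (simp_all add: L_def)
  obtain C where C: "C > 0" and rankin: "\<And>d N. d \<ge> 1 \<Longrightarrow> N \<ge> 1 \<Longrightarrow>
      real N \<le> exp (real d ^ Suc (L - 1)) \<Longrightarrow> \<exists>A\<subseteq>{1..N}. poly_free k 1 A \<and>
        real N * exp (- C * real d) \<le> real (card A)"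
    using rankin[OF L(2)] by blast
  \<comment> \<open>\<open>C\<close> comes from the density, \<open>L\<close> from
    \<open>ln N <= exp d ^ L\<close>, 1 from \<open>2 <= exp d\<close>, and the outer 2 from
    \<open>d <= 2 * x\<close>.\<close>
  define K where "K = (2 * (C + real L + 1)) ^ L"
  have "K > 0" using C by (simp add: K_def)
  moreover have "(ln (2 * (real N * ln (real N)) / real (ap_free_number k N))) ^ L \<le> K * ln (real N)"
    if N: "N \<ge> 3" for N
  proof -
    define r where "r = real (ap_free_number k N)"
    have r: "r > 0" "r \<le> real N"
      using ap_free_number_pos[OF assms(1), of N] ap_free_number_le[of k N] N assms(1)
      by (simp_all add: r_def)
    have "exp 1 \<le> real N" using exp_le N by linarith
    then have ln1: "ln (real N) \<ge> 1" using N by (subst ln_ge_iff) auto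
    define x where "x = root L (ln (real N))"
    have xL: "x ^ L = ln (real N)" using L ln1 by (simp add: x_def real_root_pow_pos2)
    have x1: "x \<ge> 1" using L ln1 by (simp add: x_def)
    define d where "d = nat \<lceil>x\<rceil>"
    have d: "d \<ge> 1" "x \<le> real d" "real d \<le> 2 * x" using x1 unfolding d_def by linarith+
    have lnd: "ln (real N) \<le> real d ^ L"
      unfolding xL[symmetric] using d(2) x1 by (intro power_mono) auto
    then have "exp (ln (real N)) \<le> exp (real d ^ L)" by simp
    then have "real N \<le> exp (real d ^ L)" using N by simp
    then obtain A where A: "A \<subseteq> {1..N}" "poly_free k 1 A" "real N * exp (- C * real d) \<le> real (card A)"
      using rankin[of d N] d(1) N L(1) by auto
    have "card A \<le> ap_free_number k N"
      using A ap_free_if_poly_free[OF _ assms(1)] by (intro card_le_ap_free_number) auto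
    then have "real N * exp (- C * real d) \<le> r" using A(3) by (simp add: r_def)
    then have Nr: "real N \<le> r * exp (C * real d)" by (simp add: exp_minus field_simps)
    have "ln (real N) > 0" using ln1 by linarith
    have "2 * (real N * ln (real N)) / r \<le> exp (real d) * (exp (C * real d) * exp (real d) ^ L)"
    proof -
      have "ln (real N) \<le> exp (real d) ^ L"
        using lnd power_mono[of "real d" "exp (real d)" L] exp_ge_add_one_self[of "real d"] by simp
      moreover have "2 \<le> exp (real d)"
        using exp_ge_add_one_self[of "real d"] d(1) by linarith
      moreover have "real N / r \<le> exp (C * real d)" using Nr r by (simp add: field_simps)
      ultimately have "2 * (real N / r * ln (real N)) \<le> exp (real d) * (exp (C * real d) * exp (real d) ^ L)"
        using r ln1 by (intro mult_mono) auto
      then show ?thesis by (simp add: mult_ac)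
    qed
    also have "\<dots> = exp ((C + real L + 1) * real d)"
      by (simp add: algebra_simps exp_of_nat_mult[symmetric] flip: exp_add)
    finally have "ln (2 * (real N * ln (real N)) / r) \<le> ln (exp ((C + real L + 1) * real d))"
      using r N \<open>ln (real N) > 0\<close> by (intro ln_mono) auto
    then have "ln (2 * (real N * ln (real N)) / r) \<le> (C + real L + 1) * real d" by simp
    also have "\<dots> \<le> (C + real L + 1) * (2 * x)"
      using d(3) C by (intro mult_left_mono) auto
    finally have upper: "ln (2 * (real N * ln (real N)) / r) \<le> 2 * (C + real L + 1) * x"
      by (simp add: algebra_simps)
    \<comment> \<open>Nonnegativity of the logarithm is needed before raising the upper bound to the
      power \<open>L\<close>.\<close>
    have "1 * 1 \<le> 2 * (real N / r * ln (real N))"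
      using r ln1 mult_mono[of 1 "real N / r" 1 "ln (real N)"] by simp
    then have "0 \<le> ln (2 * (real N * ln (real N)) / r)" by (simp add: mult_ac)
    then have "ln (2 * (real N * ln (real N)) / r) ^ L \<le> (2 * (C + real L + 1) * x) ^ L"
      using upper by (intro power_mono) auto
    also have "\<dots> = K * ln (real N)" by (simp add: K_def power_mult_distrib xL)
    finally show ?thesis unfolding r_def .
  qed
  ultimately show ?thesis by blast
qed

text \<open>The function \<open>h\<close> is the quantity hidden in the O-term, and one constant
  \<open>C\<close>, here 1/2, serves both parts. Taking \<open>n >= 1\<close> keeps
  \<open>ln (k * n)\<close> positive.\<close>

theorem theorem10:
  fixes k :: nat
  assumes "k \<ge> 3"
  shows "\<exists>C::real. C > 0 \<and>
    (\<forall>n::nat. n \<ge> 1 \<longrightarrow>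
       real (dhj_number n k) \<ge>
         C * real k ^ n * (real (ap_free_number k (k * n)) / (real (k * n) * ln (real (k * n))))) \<and>
    (\<exists>h :: nat \<Rightarrow> real.
       (\<forall>n. n \<ge> 1 \<longrightarrow> h n \<ge> 0) \<and> h \<in> O(\<lambda>n. ln (real n)) \<and>
       (\<forall>n. n \<ge> 1 \<longrightarrow>
          C * real k ^ n * (real (ap_free_number k (k * n)) / (real (k * n) * ln (real (k * n)))) =
          real k ^ n * exp (- (h n powr (1 / real_of_int \<lceil>log 2 (real k)\<rceil>)))))"
proof -
  have k2: "k \<ge> 2" using assms by simp
  define L where "L = nat \<lceil>log 2 (real k)\<rceil>"
  have L: "L \<ge> 1" "real_of_int \<lceil>log 2 (real k)\<rceil> = real L"
    using two_power_ceiling_log_less(1)[OF k2] by (simp_all add: L_def)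
  define r where "r n = real (ap_free_number k (k * n))" for n
  define l where "l n = ln (real (k * n))" for n
  \<comment> \<open>The reciprocal of the factor multiplying \<open>k ^ n\<close> in the lower bound
    with \<open>C = 1 / 2\<close>.\<close>
  define z where "z n = 2 * (real (k * n) * l n) / r n" for n
  have kn: "k * n \<ge> 3" if "n \<ge> 1" for n
    using mult_le_mono[OF assms that] by simp
  have r: "r n > 0" "r n \<le> real (k * n)" if "n \<ge> 1" for n
    using ap_free_number_pos[OF k2, of "k * n"] ap_free_number_le[of k "k * n"] kn[OF that] k2 that
    unfolding r_def by (simp_all del: of_nat_mult)
  have l: "l n \<ge> 1" if "n \<ge> 1" for n
  proof -
    have "exp 1 \<le> real (k * n)" using exp_le kn[OF that] by linarith
    then show ?thesis unfolding l_def using kn[OF that] k2 that by (subst ln_ge_iff) (simp_all del: of_nat_mult)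
  qed
  have z: "z n \<ge> 1" if "n \<ge> 1" for n
  proof -
    have "1 * 1 \<le> real (k * n) / r n * l n"
      using r[OF that] l[OF that] by (intro mult_mono) auto
    moreover have "z n = 2 * (real (k * n) / r n * l n)" by (simp add: z_def)
    ultimately show ?thesis by linarith
  qed
  have inv: "1 / 2 * real k ^ n * (r n / (real (k * n) * l n)) = real k ^ n * inverse (z n)" for n
    by (simp add: z_def divide_simps)
  have bound: "real (dhj_number n k) \<ge> 1 / 2 * real k ^ n * (r n / (real (k * n) * l n))"
    if "n \<ge> 1" for n
  proof -
    have "real (k ^ n * ap_free_number k (k * n)) \<le> real (2 * (k * n) * dhj_number n k)"
      using dhj_number_ge[OF k2 that] by (simp only: of_nat_le_iff)
    then have "real k ^ n * r n / (2 * real (k * n)) \<le> real (dhj_number n k)"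
      using k2 that by (simp add: r_def field_simps)
    \<comment> \<open>Dividing by \<open>l n >= 1\<close> only lowers the bound obtained from
      averaging.\<close>
    moreover have "real k ^ n * r n / (2 * real (k * n) * l n) \<le> real k ^ n * r n / (2 * real (k * n) * 1)"
      using r[OF that] l[OF that] k2 that
      by (intro divide_left_mono mult_left_mono) (auto intro!: mult_pos_pos)
    ultimately show ?thesis by (simp add: mult_ac)
  qed
  \<comment> \<open>Chosen so that \<open>exp (- (h n powr (1 / L)))\<close> equals
    \<open>1 / z n\<close>; this works because \<open>ln (z n)\<close> is nonnegative.\<close>
  define h where "h n = ln (z n) ^ L" for n
  have h0: "h n \<ge> 0" if "n \<ge> 1" for n
    using z[OF that] by (simp add: h_def)
  have hroot: "h n powr (1 / real L) = ln (z n)" if "n \<ge> 1" for n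
  proof -
    have "ln (z n) \<ge> 0" using z[OF that] by simp
    then have "h n = ln (z n) powr real L" using L(1) by (simp add: h_def powr_realpow')
    then show ?thesis using \<open>ln (z n) \<ge> 0\<close> L(1) by (simp add: powr_powr)
  qed
  obtain K where K: "K > 0"
    "\<And>N. N \<ge> 3 \<Longrightarrow> (ln (2 * (real N * ln (real N)) / real (ap_free_number k N))) ^ L \<le> K * ln (real N)"
    using ap_free_number_lower_bound[OF k2] unfolding L_def by blast
  have "h \<in> O(\<lambda>n. ln (real n))"
  \<comment> \<open>From \<open>n >= k\<close> on, \<open>ln (k * n) <= 2 * ln n\<close>, which
    explains both the threshold and the factor 2.\<close>
  proof (rule bigoI[of _ "2 * K"], rule eventually_sequentiallyI[of k])
    fix n assume n: "k \<le> n"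
    then have n1: "n \<ge> 1" using k2 by simp
    have "h n \<le> K * l n"
      using K(2)[OF kn[OF n1]] by (simp only: h_def z_def r_def l_def)
    also have "l n \<le> 2 * ln (real n)"
    proof -
      have "l n = ln (real k) + ln (real n)" using n1 k2 by (simp add: l_def ln_mult)
      moreover have "ln (real k) \<le> ln (real n)" using n k2 by simp
      ultimately show ?thesis by simp
    qed
    finally have "h n \<le> 2 * K * ln (real n)" using K(1) by simp
    moreover have "ln (real n) \<ge> 0" using n1 by simp
    ultimately show "norm (h n) \<le> 2 * K * norm (ln (real n))"
      using h0[OF n1] by simp
  qed
  moreover have "1 / 2 * real k ^ n * (r n / (real (k * n) * l n)) =
      real k ^ n * exp (- (h n powr (1 / real_of_int \<lceil>log 2 (real k)\<rceil>)))" if "n \<ge> 1" for n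
  proof -
    have "z n > 0" using z[OF that] by simp
    then show ?thesis unfolding inv L(2) hroot[OF that] by (simp add: exp_minus)
  qed
  ultimately show ?thesis
    using bound h0 unfolding r_def l_def
    by (intro exI[of _ "1 / 2"] conjI exI[of _ h]) auto
qed

end
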